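(* For every non-negative bivariate sum-of-products binomial $K(w_1,w_2)$, the algorithm "blow-up between variables" applied to $K$ halts.
   Context: A bivariate sum-of-products binomial is $w_1^{p}w_2^{r}+w_1^{q}w_2^{s}$ with $p,q,r,s\in\mathbb N_0$ and $(p,r)\ne(q,s)$; non-negative means $\ge0$ on $\mathbb R^2$. A normal crossing is a function $u(w)w_1^{k_1}w_2^{k_2}$ with $k_1,k_2\in\mathbb N_0$ and $u$ analytic on $\mathbb R^2$, everywhere positive or everywhere negative. Algorithm "blow-up between variables": start with the queue consisting of $K$. Repeatedly remove a polynomial $f$ from the queue; if $f$ is a normal crossing, do nothing further with it; otherwise blow up with center the origin $\{w_1=w_2=0\}$, i.e. add to the queue the two polynomials $f_1(w_1,w_2)=f(w_1w_2,w_2)$ and $f_2(w_1,w_2)=f(w_1,w_1w_2)$. The algorithm halts when the queue is empty. *)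

theory Defs
  imports "HOL-Analysis.Analysis" "HOL-Library.Multiset"
begin

text \<open>
  Polynomials in \<open>(w1, w2)\<close> with real coefficients are represented by the functions
  they induce on the plane; over the reals this representation is faithful.
\<close>

type_synonym planefun = "real \<times> real \<Rightarrow> real"

definition sop_binomial :: "planefun \<Rightarrow> bool" where
  "sop_binomial K \<longleftrightarrow>
     (\<exists>p q r s :: nat. (p, r) \<noteq> (q, s) \<and> K = (\<lambda>(w1, w2). w1 ^ p * w2 ^ r + w1 ^ q * w2 ^ s))"

definition nonneg_fun :: "planefun \<Rightarrow> bool" where
  "nonneg_fun K \<longleftrightarrow> (\<forall>w. K w \<ge> 0)"

text \<open>
  Real analyticity on the whole plane: around every point the function is the sum of a double
  power series. For real families, \<open>has_sum\<close> is absolute convergence.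
\<close>

definition real_analytic_plane :: "planefun \<Rightarrow> bool" where
  "real_analytic_plane u \<longleftrightarrow>
     (\<forall>a b. \<exists>\<rho>>0. \<exists>c :: nat \<Rightarrow> nat \<Rightarrow> real. \<forall>x y. \<bar>x - a\<bar> < \<rho> \<longrightarrow> \<bar>y - b\<bar> < \<rho> \<longrightarrow>
        ((\<lambda>(i, j). c i j * (x - a) ^ i * (y - b) ^ j) has_sum u (x, y)) UNIV)"

definition normal_crossing :: "planefun \<Rightarrow> bool" where
  "normal_crossing f \<longleftrightarrow>
     (\<exists>u k1 k2. real_analytic_plane u \<and> ((\<forall>w. u w > 0) \<or> (\<forall>w. u w < 0)) \<and>
        f = (\<lambda>(w1, w2). u (w1, w2) * w1 ^ k1 * w2 ^ k2))"

definition blowup1 :: "planefun \<Rightarrow> planefun" where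
  "blowup1 f = (\<lambda>(w1, w2). f (w1 * w2, w2))"

definition blowup2 :: "planefun \<Rightarrow> planefun" where
  "blowup2 f = (\<lambda>(w1, w2). f (w1, w1 * w2))"

text \<open>
  One pass of the loop. The queue is a multiset and any of its entries may be removed, so every
  selection order (first-in-first-out in particular) is covered.
\<close>

inductive queue_step :: "planefun multiset \<Rightarrow> planefun multiset \<Rightarrow> bool" where
  discard: "normal_crossing f \<Longrightarrow> queue_step (add_mset f Q) Q"
| blow_up: "\<not> normal_crossing f \<Longrightarrow>
    queue_step (add_mset f Q) (add_mset (blowup1 f) (add_mset (blowup2 f) Q))"

text \<open>
  A run is a sequence of queues driven by \<open>queue_step\<close> as long as the queue is nonempty; what
  follows the first empty queue is irrelevant. Some step is always possible from a
  nonempty queue, so no run gets stuck.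
\<close>

definition blowup_run :: "planefun \<Rightarrow> (nat \<Rightarrow> planefun multiset) \<Rightarrow> bool" where
  "blowup_run K Q \<longleftrightarrow> Q 0 = {#K#} \<and> (\<forall>n. Q n \<noteq> {#} \<longrightarrow> queue_step (Q n) (Q (Suc n)))"

definition blowup_halts :: "planefun \<Rightarrow> bool" where
  "blowup_halts K \<longleftrightarrow> (\<forall>Q. blowup_run K Q \<longrightarrow> (\<exists>n. Q n = {#}))"

lemma queue_step_enabled: "Q \<noteq> {#} \<Longrightarrow> \<exists>Q'. queue_step Q Q'"
  by (metis multiset_cases queue_step.intros)

lemma blowup_run_exists: "\<exists>Q. blowup_run K Q"
proof -
  define nxt where "nxt = (\<lambda>Q. SOME Q'. queue_step Q Q')"
  have "queue_step Q (nxt Q)" if "Q \<noteq> {#}" for Q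
    unfolding nxt_def using queue_step_enabled[OF that] by (rule someI_ex)
  then have "blowup_run K (\<lambda>n. (nxt ^^ n) {#K#})"
    by (simp add: blowup_run_def)
  then show ?thesis by blast
qed

end

theory Submission imports Defs begin

text \<open>
  Non-negativity forces all four exponents to be even, and blowing up keeps them even. If one
  exponent vector dominates the other, the binomial is a monomial times
  \<open>1 + w1 ^ c * w2 ^ d\<close> with even \<open>c\<close>, \<open>d\<close>, hence a normal crossing. Otherwise the difference of the
  exponent vectors is \<open>(c, - d)\<close> up to sign with \<open>c, d > 0\<close>, and the two blow-ups
  turn it into \<open>(c, c - d)\<close> and \<open>(c - d, - d)\<close>: as in the subtractive Euclidean algorithm, either the
  exponents become comparable or \<open>c + d\<close> drops.
\<close>

lemma real_analytic_plane_add: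
  assumes "real_analytic_plane u" and "real_analytic_plane v"
  shows "real_analytic_plane (\<lambda>w. u w + v w)"
  unfolding real_analytic_plane_def
proof (intro allI)
  fix a b
  obtain \<rho> c where \<rho>: "\<rho> > 0" and c: "\<And>x y. \<bar>x - a\<bar> < \<rho> \<Longrightarrow> \<bar>y - b\<bar> < \<rho> \<Longrightarrow>
      ((\<lambda>(i, j). c i j * (x - a) ^ i * (y - b) ^ j) has_sum u (x, y)) UNIV"
    using assms(1)[unfolded real_analytic_plane_def, rule_format, of a b] by blast
  obtain \<sigma> d where \<sigma>: "\<sigma> > 0" and d: "\<And>x y. \<bar>x - a\<bar> < \<sigma> \<Longrightarrow> \<bar>y - b\<bar> < \<sigma> \<Longrightarrow>
      ((\<lambda>(i, j). d i j * (x - a) ^ i * (y - b) ^ j) has_sum v (x, y)) UNIV"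
    using assms(2)[unfolded real_analytic_plane_def, rule_format, of a b] by blast
  have "((\<lambda>(i, j). (c i j + d i j) * (x - a) ^ i * (y - b) ^ j) has_sum u (x, y) + v (x, y)) UNIV"
    if "\<bar>x - a\<bar> < min \<rho> \<sigma>" "\<bar>y - b\<bar> < min \<rho> \<sigma>" for x y
    using has_sum_add[OF c[of x y] d[of x y]] that
    by (simp add: case_prod_unfold algebra_simps)
  then show "\<exists>\<rho>>0. \<exists>c. \<forall>x y. \<bar>x - a\<bar> < \<rho> \<longrightarrow> \<bar>y - b\<bar> < \<rho> \<longrightarrow>
      ((\<lambda>(i, j). c i j * (x - a) ^ i * (y - b) ^ j) has_sum u (x, y) + v (x, y)) UNIV"
    using \<rho> \<sigma> by (intro exI[of _ "min \<rho> \<sigma>"] conjI exI[of _ "\<lambda>i j. c i j + d i j"]) auto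
qed

text \<open>Expanding both powers around \<open>(a, b)\<close> by the binomial theorem gives a
  finite double sum valid for all \<open>x\<close> and \<open>y\<close>, so any radius will
  do.\<close>

lemma real_analytic_plane_monomial: "real_analytic_plane (\<lambda>(x, y). x ^ m * y ^ n)"
  unfolding real_analytic_plane_def
proof (intro allI)
  fix a b :: real
  define c where "c i j = (of_nat (m choose i) * a ^ (m - i)) * (of_nat (n choose j) * b ^ (n - j))"
    for i j
  have "((\<lambda>(i, j). c i j * (x - a) ^ i * (y - b) ^ j) has_sum x ^ m * y ^ n) UNIV" for x y
  proof (rule has_sum_finite_neutralI)
    show "finite ({..m} \<times> {..n})" by simp
    \<comment> \<open>For \<open>i > m\<close> the exponent \<open>m - i\<close> is cut off at 0,
      but the factor \<open>m choose i\<close> vanishes; likewise for \<open>j > n\<close>.\<close>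
    show "(case z of (i, j) \<Rightarrow> c i j * (x - a) ^ i * (y - b) ^ j) = 0"
      if "z \<in> UNIV - {..m} \<times> {..n}" for z
      using that by (cases z) (auto simp: c_def binomial_eq_0)
    have "x ^ m * y ^ n = ((x - a) + a) ^ m * ((y - b) + b) ^ n" by simp
    also have "\<dots> = (\<Sum>i\<le>m. \<Sum>j\<le>n. c i j * (x - a) ^ i * (y - b) ^ j)"
      unfolding binomial_ring sum_product c_def by (intro sum.cong refl) (simp add: mult_ac)
    finally show "x ^ m * y ^ n = (\<Sum>(i, j)\<in>{..m} \<times> {..n}. c i j * (x - a) ^ i * (y - b) ^ j)"
      by (simp add: sum.cartesian_product)
  qed auto
  then show "\<exists>\<rho>>0. \<exists>c. \<forall>x y. \<bar>x - a\<bar> < \<rho> \<longrightarrow> \<bar>y - b\<bar> < \<rho> \<longrightarrow>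
      ((\<lambda>(i, j). c i j * (x - a) ^ i * (y - b) ^ j) has_sum
        (case (x, y) of (x, y) \<Rightarrow> x ^ m * y ^ n)) UNIV"
    by (intro exI[of _ 1] conjI exI[of _ c]) auto
qed

definition binomial_fun :: "nat \<Rightarrow> nat \<Rightarrow> nat \<Rightarrow> nat \<Rightarrow> planefun" where
  "binomial_fun p r q s = (\<lambda>(w1, w2). w1 ^ p * w2 ^ r + w1 ^ q * w2 ^ s)"

lemma binomial_fun_commute: "binomial_fun p r q s = binomial_fun q s p r"
  by (simp add: binomial_fun_def add.commute)

lemma blowup1_binomial_fun: "blowup1 (binomial_fun p r q s) = binomial_fun p (p + r) q (q + s)"
  by (simp add: blowup1_def binomial_fun_def power_mult_distrib power_add mult_ac)

lemma blowup2_binomial_fun: "blowup2 (binomial_fun p r q s) = binomial_fun (p + r) r (q + s) s"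
  by (simp add: blowup2_def binomial_fun_def power_mult_distrib power_add mult_ac)

lemma normal_crossing_binomial_fun_le:
  assumes "p \<le> q" "r \<le> s" "even p" "even q" "even r" "even s"
  shows "normal_crossing (binomial_fun p r q s)"
proof -
  define u :: planefun where "u = (\<lambda>(w1, w2). 1 + w1 ^ (q - p) * w2 ^ (s - r))"
  have "real_analytic_plane u"
    \<comment> \<open>The constant 1 enters as the monomial with both exponents 0.\<close>
    using real_analytic_plane_add[OF real_analytic_plane_monomial[of 0 0]
        real_analytic_plane_monomial[of "q - p" "s - r"]]
    by (simp add: u_def case_prod_unfold)
  moreover have "u w > 0" for w
    using assms by (auto simp: u_def case_prod_unfold intro!: add_pos_nonneg mult_nonneg_nonneg zero_le_even_power)
  moreover have "binomial_fun p r q s = (\<lambda>(w1, w2). u (w1, w2) * w1 ^ p * w2 ^ r)"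
  proof -
    have "w1 ^ q * w2 ^ s = w1 ^ (q - p) * w2 ^ (s - r) * w1 ^ p * w2 ^ r" for w1 w2 :: real
      using power_add[of w1 "q - p" p] power_add[of w2 "s - r" r] assms(1,2) by simp
    then show ?thesis by (simp add: binomial_fun_def u_def algebra_simps)
  qed
  ultimately show ?thesis unfolding normal_crossing_def by blast
qed

text \<open>Of two distinct exponents the smaller dominates at \<open>- (1 / 2)\<close> and the
  larger at \<open>- 2\<close>; if the dominating one is odd, the sum is negative there. Equal
  exponents are tested at \<open>- 1\<close>.\<close>

lemma even_exponents_of_nonneg:
  fixes m n :: nat
  assumes "\<And>x :: real. x ^ m + x ^ n \<ge> 0"
  shows "even m \<and> even n"
proof -
  have neg: "(- x) ^ k + (- x) ^ l < 0" if "odd k" "x > 0" "x ^ l < x ^ k" for x :: real and k l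
  proof -
    have "(- x) ^ l \<le> x ^ l" using \<open>x > 0\<close> by (cases "even l") simp_all
    then show ?thesis using that by simp
  qed
  have lt: "even k \<and> even l" if nonneg: "\<And>x :: real. x ^ k + x ^ l \<ge> 0" and "k < l" for k l :: nat
  proof (intro conjI; rule ccontr)
    assume "odd k"
    moreover have "(1 / 2 :: real) ^ l < (1 / 2) ^ k"
      using \<open>k < l\<close> by (intro power_strict_decreasing) auto
    ultimately show False using neg[of k "1 / 2" l] nonneg[of "- (1 / 2)"] by linarith
  next
    assume "odd l"
    moreover have "(2 :: real) ^ k < 2 ^ l"
      using \<open>k < l\<close> by (intro power_strict_increasing) auto
    ultimately show False using neg[of l 2 k] nonneg[of "- 2"] by linarith
  qed
  consider "m < n" | "n < m" | "m = n" by linarith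
  then show ?thesis
  proof cases
    case 1
    then show ?thesis using lt assms by blast
  next
    case 2
    then show ?thesis using lt[of n m] assms by (simp add: add.commute)
  next
    case 3
    then show ?thesis using assms[of "- 1"] by (cases "even n") auto
  qed
qed

lemma even_exponents_of_nonneg_fun:
  assumes "nonneg_fun (binomial_fun p r q s)"
  shows "even p \<and> even q \<and> even r \<and> even s"
proof -
  have "binomial_fun p r q s (x, y) \<ge> 0" for x y
    using assms by (simp add: nonneg_fun_def)
  \<comment> \<open>Restricting to the lines \<open>w2 = 1\<close> and \<open>w1 = 1\<close> leaves
    one-variable sums with exponents \<open>p\<close>, \<open>q\<close> and \<open>r\<close>,
    \<open>s\<close>.\<close>
  from this[of _ 1] this[of 1] show ?thesis
    using even_exponents_of_nonneg[of p q] even_exponents_of_nonneg[of r s]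
    by (simp add: binomial_fun_def)
qed

text \<open>
  A polynomial of rank \<open>n\<close> costs at most \<open>2 ^ (n + 1) - 1\<close> steps, so the total cost of the queue
  strictly decreases.
\<close>

lemma blowup_halts_by_rank:
  fixes rank :: "planefun \<Rightarrow> nat"
  assumes "P K"
    and step: "\<And>f. P f \<Longrightarrow> \<not> normal_crossing f \<Longrightarrow>
      P (blowup1 f) \<and> P (blowup2 f) \<and> rank (blowup1 f) < rank f \<and> rank (blowup2 f) < rank f"
  shows "blowup_halts K"
  unfolding blowup_halts_def
proof (intro allI impI)
  fix Q assume run: "blowup_run K Q"
  define cost where "cost f = 2 ^ Suc (rank f) - (1 :: nat)" for f
  define total where "total M = (\<Sum>f\<in>#M. cost f)" for M
  have Suc_cost: "Suc (cost f) = 2 ^ Suc (rank f)" for f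
    by (simp add: cost_def)
  \<comment> \<open>Even at rank 0 the cost is 1, so discarding an entry lowers the total.\<close>
  have cost_pos: "cost f > 0" for f
    using Suc_cost[of f] by (cases "cost f") auto
  \<comment> \<open>Each blow-up costs at most \<open>2 ^ rank f - 1\<close>, so the two together
    stay below \<open>cost f = 2 * 2 ^ rank f - 1\<close>.\<close>
  have cost_blowup: "cost (blowup1 f) + cost (blowup2 f) < cost f"
    if "P f" "\<not> normal_crossing f" for f
  proof -
    have "2 ^ Suc (rank g) \<le> (2 :: nat) ^ rank f" if "rank g < rank f" for g
      using that by (intro power_increasing) auto
    from this[of "blowup1 f"] this[of "blowup2 f"]
    have "2 ^ Suc (rank (blowup1 f)) \<le> (2 :: nat) ^ rank f"
      "2 ^ Suc (rank (blowup2 f)) \<le> (2 :: nat) ^ rank f"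
      using step[OF that] by auto
    moreover have "Suc (cost f) = 2 * 2 ^ rank f"
      by (simp add: Suc_cost)
    ultimately show ?thesis
      using Suc_cost[of "blowup1 f"] Suc_cost[of "blowup2 f"] by linarith
  qed
  have decr: "(\<forall>f\<in>#M'. P f) \<and> total M' < total M" if "queue_step M M'" "\<forall>f\<in>#M. P f" for M M'
    using that
  proof cases
    case (discard f)
    then show ?thesis using that(2) cost_pos[of f] by (auto simp: total_def)
  next
    case (blow_up f R)
    then show ?thesis using that(2) step[of f] cost_blowup[of f] by (auto simp: total_def)
  qed
  show "\<exists>n. Q n = {#}"
  proof (rule ccontr)
    assume "\<nexists>n. Q n = {#}"
    then have steps: "queue_step (Q n) (Q (Suc n))" for n
      using run by (auto simp: blowup_run_def)
    have P: "\<forall>f\<in>#Q n. P f" for n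
    proof (induction n)
      case 0
      then show ?case using run assms(1) by (simp add: blowup_run_def)
    next
      case (Suc n)
      then show ?case using decr[OF steps[of n]] by blast
    qed
    then have "(total (Q (Suc n)), total (Q n)) \<in> less_than" for n
      using decr steps by simp
    then show False
      using wf_no_infinite_down_chainE[OF wf_less_than, of "\<lambda>n. total (Q n)"] by blast
  qed
qed

text \<open>The l1 distance of the exponent vectors, reset to 0 for comparable ones. The reset
  matters: \<open>(c, - d)\<close> can become \<open>(c, c - d)\<close> with
  \<open>c \<ge> 2 * d\<close>, whose l1 norm is no smaller.\<close>

definition gap :: "nat \<Rightarrow> nat \<Rightarrow> nat \<Rightarrow> nat \<Rightarrow> nat" where
  "gap p r q s = (if p \<le> q \<and> r \<le> s \<or> q \<le> p \<and> s \<le> r then 0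
     else nat (\<bar>int p - int q\<bar> + \<bar>int r - int s\<bar>))"

text \<open>Up to exchanging the monomials the difference is \<open>(c, - d)\<close> with
  \<open>c, d > 0\<close> and gap \<open>c + d\<close>. The first blow-up has gap 0 if
  \<open>c \<ge> d\<close> and \<open>d\<close> otherwise; the second has gap 0 if
  \<open>c \<le> d\<close> and \<open>c\<close> otherwise.\<close>

lemma gap_blowup:
  assumes "\<not> (p \<le> q \<and> r \<le> s)" "\<not> (q \<le> p \<and> s \<le> r)"
  shows "gap p (p + r) q (q + s) < gap p r q s" and "gap (p + r) r (q + s) s < gap p r q s"
  using assms by (auto simp: gap_def)

text \<open>A relation, so that exponents need not be recovered uniquely from the function
  \<open>f\<close>.\<close>

definition even_binomial_gap :: "planefun \<Rightarrow> nat \<Rightarrow> bool" where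
  "even_binomial_gap f n \<longleftrightarrow> (\<exists>p q r s. even p \<and> even q \<and> even r \<and> even s \<and>
     f = binomial_fun p r q s \<and> gap p r q s = n)"

lemma even_binomial_gap_blowup:
  assumes "even_binomial_gap f n" and "\<not> normal_crossing f"
  shows "\<exists>k<n. even_binomial_gap (blowup1 f) k" and "\<exists>k<n. even_binomial_gap (blowup2 f) k"
proof -
  obtain p q r s where ev: "even p" "even q" "even r" "even s"
    and f: "f = binomial_fun p r q s" and n: "gap p r q s = n"
    using assms(1) by (auto simp: even_binomial_gap_def)
  \<comment> \<open>The second case is the first with the two monomials exchanged.\<close>
  have "\<not> (p \<le> q \<and> r \<le> s)" "\<not> (q \<le> p \<and> s \<le> r)"
    using assms(2) ev normal_crossing_binomial_fun_le f binomial_fun_commute by metis+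
  note gap = gap_blowup[OF this, unfolded n]
  have "even_binomial_gap (blowup1 f) (gap p (p + r) q (q + s))"
    using ev unfolding even_binomial_gap_def f blowup1_binomial_fun by (metis even_add)
  with gap(1) show "\<exists>k<n. even_binomial_gap (blowup1 f) k" by blast
  have "even_binomial_gap (blowup2 f) (gap (p + r) r (q + s) s)"
    using ev unfolding even_binomial_gap_def f blowup2_binomial_fun by (metis even_add)
  with gap(2) show "\<exists>k<n. even_binomial_gap (blowup2 f) k" by blast
qed

theorem proposition3p2:
  fixes K :: "real \<times> real \<Rightarrow> real"
  assumes "sop_binomial K" and "nonneg_fun K"
  shows "blowup_halts K"
proof (rule blowup_halts_by_rank[where P = "\<lambda>f. \<exists>n. even_binomial_gap f n"
      and rank = "\<lambda>f. LEAST n. even_binomial_gap f n"])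
  obtain p q r s where K: "K = binomial_fun p r q s"
    using assms(1) by (auto simp: sop_binomial_def binomial_fun_def)
  have "even_binomial_gap K (gap p r q s)"
    unfolding even_binomial_gap_def
    using even_exponents_of_nonneg_fun[OF assms(2)[unfolded K]] K
    by (intro exI[of _ p] exI[of _ q] exI[of _ r] exI[of _ s]) simp
  then show "\<exists>n. even_binomial_gap K n" ..
next
  have Least_less: "(LEAST n. even_binomial_gap g n) < m"
    if ex: "\<exists>k<m. even_binomial_gap g k" for g m
  proof -
    obtain k where "k < m" "even_binomial_gap g k" using ex by blast
    then show ?thesis using Least_le[of "even_binomial_gap g" k] by simp
  qed
  fix f assume ex: "\<exists>n. even_binomial_gap f n" and nc: "\<not> normal_crossing f"
  \<comment> \<open>The descent starts from exponents attaining the least gap of \<open>f\<close>;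
    the smaller gaps it yields bound the least gaps of both blow-ups.\<close>
  from ex have "even_binomial_gap f (LEAST n. even_binomial_gap f n)"
    by (rule LeastI_ex)
  note less = even_binomial_gap_blowup[OF this nc]
  show "(\<exists>n. even_binomial_gap (blowup1 f) n) \<and> (\<exists>n. even_binomial_gap (blowup2 f) n) \<and>
      (LEAST n. even_binomial_gap (blowup1 f) n) < (LEAST n. even_binomial_gap f n) \<and>
      (LEAST n. even_binomial_gap (blowup2 f) n) < (LEAST n. even_binomial_gap f n)"
    using less Least_less[OF less(1)] Least_less[OF less(2)] by auto
qed

end
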